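(* Let $E$ be a Banach space and let $\mathcal{A}=(A_n)_{n\in\mathbb{N}}$ be a sequence of bounded linear operators on $E$ (not necessarily invertible). Assume that $0\notin\sigma_{ap}(G_\alpha)$ for some $\alpha\in\mathcal{E}_{ad}(\mathcal{A})$. Then there exist a constant $\nu>0$ and a positive real sequence $(N_k)_{k\in\mathbb{N}}$ such that, for every $n\in\mathbb{N}$ and every $x_0\in E$ with $$\sup_{m\geq n}\|A(m,n)x_0\|<\infty,$$ one has $$\|A(m,n)x_0\|\leq N_n e^{-\nu(m-n)}\|x_0\|\quad\text{for all integers } m\geq n.$$ (In particular $\nu$ and the sequence $(N_k)_{k\in\mathbb{N}}$ do not depend on $n$ and $x_0$.)
   Context: $\mathbb{N}=\{0,1,2,\ldots\}$, $\Delta=\{(m,n)\in\mathbb{N}\times\mathbb{N}: m\geq n\}$. For $(m,n)\in\Delta$ put $A(m,n)=A_{m-1}\cdots A_n$ if $m>n$ and $A(n,n)=\mathrm{Id}$. A real number $\alpha$ is an admissible exponent for $\mathcal{A}$ if there is a (not necessarily bounded) positive real sequence $(M_n)_{n\in\mathbb{N}}$ with $\|A(m,n)\|\leq M_n e^{\alpha(m-n)}$ for all $(m,n)\in\Delta$. $\mathcal{E}_{ad}(\mathcal{A})$ is the set of all admissible exponents of $\mathcal{A}$. For $\alpha\in\mathcal{E}_{ad}(\mathcal{A})$ and $n\in\mathbb{N}$, $\|x\|_{n,\alpha}=\sup_{m\geq n}e^{-\alpha(m-n)}\|A(m,n)x\|$, $x\in E$; this is a norm on $E$ with $\|x\|\leq\|x\|_{n,\alpha}\leq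 M_n\|x\|$. The space $c_{00}(\alpha)$ is the set of sequences $u=(u_n)_{n\in\mathbb{N}}$ in $E$ with $u_0=0$ and $\lim_{n\to\infty}\|u_n\|_{n,\alpha}=0$; it is a Banach space with norm $\|u\|_\alpha=\sup_{n\in\mathbb{N}}\|u_n\|_{n,\alpha}$. The evolution map $T$ acts on $E$-valued sequences by $(Tu)_0=0$ and $(Tu)_n=A_{n-1}u_{n-1}$ for $n\geq1$. $T_\alpha$ is its restriction to $c_{00}(\alpha)$, which is a bounded linear operator $c_{00}(\alpha)\to c_{00}(\alpha)$, and $G_\alpha=T_\alpha-\mathrm{Id}$ on $c_{00}(\alpha)$. The approximate point spectrum $\sigma_{ap}(S)$ of a bounded linear operator $S:X\to X$ on a Banach space $X$ is the set of scalars $\lambda$ such that for every $\varepsilon>0$ there is $x\in X$ with $\|x\|=1$ and $\|\lambda x-Sx\|\leq\varepsilon$. *)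

theory Defs
  imports "HOL-Analysis.Analysis"
begin

text \<open>
  The Banach space \<open>E\<close> is a type of class \<^class>\<open>banach\<close>, i.e. a real Banach space; a complex
  Banach space is covered through its underlying real structure.
\<close>

text \<open>\<open>cocycle A m n\<close> is \<open>A(m,n)\<close>; only pairs with \<open>m \<ge> n\<close> are ever used, and for \<open>m < n\<close> the
  value is the identity by convention.\<close>

primrec cocycle :: "(nat \<Rightarrow> 'a::banach \<Rightarrow>\<^sub>L 'a) \<Rightarrow> nat \<Rightarrow> nat \<Rightarrow> 'a \<Rightarrow>\<^sub>L 'a" where
  "cocycle A 0 n = id_blinfun"
| "cocycle A (Suc m) n = (if n \<le> m then A m o\<^sub>L cocycle A m n else id_blinfun)"

definition admissible_exponents :: "(nat \<Rightarrow> 'a::banach \<Rightarrow>\<^sub>L 'a) \<Rightarrow> real set" where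
  "admissible_exponents A =
     {\<alpha>. \<exists>M :: nat \<Rightarrow> real. (\<forall>n. 0 < M n) \<and>
          (\<forall>m n. n \<le> m \<longrightarrow> norm (cocycle A m n) \<le> M n * exp (\<alpha> * real (m - n)))}"

text \<open>For admissible \<open>\<alpha>\<close> the suprema below are over nonempty sets that are bounded above
  (see \<open>bdd_above_adapted\<close> and \<open>bdd_above_c00\<close>), so \<^term>\<open>Sup\<close> on \<open>real\<close> is the genuine supremum.\<close>

definition adapted_norm :: "(nat \<Rightarrow> 'a::banach \<Rightarrow>\<^sub>L 'a) \<Rightarrow> real \<Rightarrow> nat \<Rightarrow> 'a \<Rightarrow> real" where
  "adapted_norm A \<alpha> n x =
     (SUP m\<in>{n..}. exp (- \<alpha> * real (m - n)) * norm (cocycle A m n x))"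

definition c00 :: "(nat \<Rightarrow> 'a::banach \<Rightarrow>\<^sub>L 'a) \<Rightarrow> real \<Rightarrow> (nat \<Rightarrow> 'a) set" where
  "c00 A \<alpha> = {u. u 0 = 0 \<and> (\<lambda>n. adapted_norm A \<alpha> n (u n)) \<longlonglongrightarrow> 0}"

definition c00_norm :: "(nat \<Rightarrow> 'a::banach \<Rightarrow>\<^sub>L 'a) \<Rightarrow> real \<Rightarrow> (nat \<Rightarrow> 'a) \<Rightarrow> real" where
  "c00_norm A \<alpha> u = (SUP n. adapted_norm A \<alpha> n (u n))"

definition evolution_map :: "(nat \<Rightarrow> 'a::banach \<Rightarrow>\<^sub>L 'a) \<Rightarrow> (nat \<Rightarrow> 'a) \<Rightarrow> nat \<Rightarrow> 'a" where
  "evolution_map A u n = (if n = 0 then 0 else A (n - 1) (u (n - 1)))"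

definition T_op :: "(nat \<Rightarrow> 'a::banach \<Rightarrow>\<^sub>L 'a) \<Rightarrow> real \<Rightarrow> (nat \<Rightarrow> 'a) \<Rightarrow> nat \<Rightarrow> 'a" where
  "T_op A \<alpha> = restrict (evolution_map A) (c00 A \<alpha>)"

definition G_op :: "(nat \<Rightarrow> 'a::banach \<Rightarrow>\<^sub>L 'a) \<Rightarrow> real \<Rightarrow> (nat \<Rightarrow> 'a) \<Rightarrow> nat \<Rightarrow> 'a" where
  "G_op A \<alpha> = restrict (\<lambda>u n. T_op A \<alpha> u n - u n) (c00 A \<alpha>)"

text \<open>Approximate point spectrum of an operator \<open>S\<close> on a space \<open>X\<close> of sequences normed by \<open>N\<close>.
  The space depends on \<open>A\<close> and \<open>\<alpha>\<close>, so it is a carrier set with an explicit norm rather than a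
  type; the vector operations are pointwise.\<close>

definition approx_point_spectrum ::
  "(nat \<Rightarrow> 'a::real_vector) set \<Rightarrow> ((nat \<Rightarrow> 'a) \<Rightarrow> real) \<Rightarrow>
   ((nat \<Rightarrow> 'a) \<Rightarrow> nat \<Rightarrow> 'a) \<Rightarrow> real set" where
  "approx_point_spectrum X N S =
     {\<mu>. \<forall>\<epsilon>>0. \<exists>u\<in>X. N u = 1 \<and> N (\<lambda>n. \<mu> *\<^sub>R u n - S u n) \<le> \<epsilon>}"

lemma adapted_term_le:
  assumes "\<forall>m n. n \<le> m \<longrightarrow> norm (cocycle A m n) \<le> M n * exp (\<alpha> * real (m - n))" "n \<le> m"
  shows "exp (- \<alpha> * real (m - n)) * norm (cocycle A m n x) \<le> M n * norm x"
proof -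
  have "norm (cocycle A m n x) \<le> norm (cocycle A m n) * norm x"
    by (rule norm_blinfun)
  also have "\<dots> \<le> (M n * exp (\<alpha> * real (m - n))) * norm x"
    using assms by (intro mult_right_mono) auto
  finally have "exp (- \<alpha> * real (m - n)) * norm (cocycle A m n x)
      \<le> exp (- \<alpha> * real (m - n)) * ((M n * exp (\<alpha> * real (m - n))) * norm x)"
    by (intro mult_left_mono) auto
  also have "\<dots> = M n * norm x"
    by (simp add: exp_minus field_simps)
  finally show ?thesis .
qed

lemma bdd_above_adapted:
  assumes "\<alpha> \<in> admissible_exponents A"
  shows "bdd_above ((\<lambda>m. exp (- \<alpha> * real (m - n)) * norm (cocycle A m n x)) ` {n..})"
proof -
  obtain M where M: "\<forall>m n. n \<le> m \<longrightarrow> norm (cocycle A m n) \<le> M n * exp (\<alpha> * real (m - n))"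
    using assms unfolding admissible_exponents_def by blast
  show ?thesis
    by (rule bdd_aboveI2[where M = "M n * norm x"]) (use adapted_term_le[OF M] in auto)
qed

lemma cocycle_same [simp]: "cocycle A n n = id_blinfun"
  by (cases n) auto

lemma norm_le_adapted_norm:
  assumes "\<alpha> \<in> admissible_exponents A"
  shows "norm x \<le> adapted_norm A \<alpha> n x"
  unfolding adapted_norm_def
  by (rule cSUP_upper2[OF bdd_above_adapted[OF assms], of n]) auto

lemma adapted_norm_le:
  assumes "\<forall>m n. n \<le> m \<longrightarrow> norm (cocycle A m n) \<le> M n * exp (\<alpha> * real (m - n))"
  shows "adapted_norm A \<alpha> n x \<le> M n * norm x"
  unfolding adapted_norm_def
  by (rule cSUP_least) (use adapted_term_le[OF assms] in auto)

lemma bdd_above_c00: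
  assumes "u \<in> c00 A \<alpha>"
  shows "bdd_above (range (\<lambda>n. adapted_norm A \<alpha> n (u n)))"
  using assms unfolding c00_def
  by (auto intro!: bounded_imp_bdd_above convergent_imp_bounded)

lemma cocycle_Suc_right:
  assumes "n < m"
  shows "cocycle A m n = cocycle A m (Suc n) o\<^sub>L A n"
  using assms
proof (induction m)
  case (Suc m)
  show ?case
  proof (cases "n = m")
    case True
    then show ?thesis by (simp add: blinfun_eqI)
  next
    case False
    with Suc show ?thesis by (auto intro!: blinfun_eqI)
  qed
qed simp

lemma adapted_norm_step:
  assumes "\<alpha> \<in> admissible_exponents A"
  shows "adapted_norm A \<alpha> (Suc n) (A n x) \<le> exp \<alpha> * adapted_norm A \<alpha> n x"
  unfolding adapted_norm_def[of A \<alpha> "Suc n"]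
proof (rule cSUP_least)
  fix m assume "m \<in> {Suc n..}"
  then have m: "n < m" by auto
  have "exp (- \<alpha> * real (m - n)) * norm (cocycle A m n x) \<le> adapted_norm A \<alpha> n x"
    unfolding adapted_norm_def
    by (rule cSUP_upper[OF _ bdd_above_adapted[OF assms]]) (use m in auto)
  then have "exp \<alpha> * (exp (- \<alpha> * real (m - n)) * norm (cocycle A m n x))
      \<le> exp \<alpha> * adapted_norm A \<alpha> n x"
    by (intro mult_left_mono) auto
  moreover have "exp \<alpha> * exp (- \<alpha> * real (m - n)) = exp (- \<alpha> * real (m - Suc n))"
    using m by (simp add: exp_add[symmetric] of_nat_diff algebra_simps)
  ultimately show "exp (- \<alpha> * real (m - Suc n)) * norm (cocycle A m (Suc n) (A n x))
      \<le> exp \<alpha> * adapted_norm A \<alpha> n x"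
    by (metis cocycle_Suc_right[OF m, of A] blinfun_apply_blinfun_compose mult.assoc)
qed auto

lemma T_op_c00:
  assumes "\<alpha> \<in> admissible_exponents A" "u \<in> c00 A \<alpha>"
  shows "T_op A \<alpha> u \<in> c00 A \<alpha>"
proof -
  have lim: "(\<lambda>n. adapted_norm A \<alpha> n (u n)) \<longlonglongrightarrow> 0"
    using assms(2) by (simp add: c00_def)
  have "(\<lambda>n. adapted_norm A \<alpha> (Suc n) (A n (u n))) \<longlonglongrightarrow> 0"
  proof (rule tendsto_sandwich[of "\<lambda>_. 0"])
    show "\<forall>\<^sub>F n in sequentially. 0 \<le> adapted_norm A \<alpha> (Suc n) (A n (u n))"
      using norm_le_adapted_norm[OF assms(1)] norm_ge_zero order_trans
      by (intro always_eventually) blast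
    show "\<forall>\<^sub>F n in sequentially. adapted_norm A \<alpha> (Suc n) (A n (u n))
        \<le> exp \<alpha> * adapted_norm A \<alpha> n (u n)"
      using adapted_norm_step[OF assms(1)] by (intro always_eventually) blast
    show "(\<lambda>n. exp \<alpha> * adapted_norm A \<alpha> n (u n)) \<longlonglongrightarrow> 0"
      using tendsto_mult_right_zero[OF lim] by simp
  qed simp
  then have "(\<lambda>n. adapted_norm A \<alpha> n (evolution_map A u n)) \<longlonglongrightarrow> 0"
    by (subst filterlim_sequentially_Suc[symmetric]) (simp add: evolution_map_def)
  then show ?thesis
    using assms(2) by (simp add: T_op_def c00_def evolution_map_def)
qed

end

theory Submission imports Defs begin

text \<open>
  If \<open>\<alpha> < 0\<close>, admissibility is already the claim. If \<open>\<alpha> \<ge> 0\<close>, a bounded orbit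
  \<open>x\<^sub>k = A(k,n) x\<^sub>0\<close> is also bounded in the adapted norms. Since \<open>0\<close> is not an approximate
  eigenvalue, \<open>G\<^sub>\<alpha>\<close> is bounded below by some \<open>c > 0\<close>. Test this bound on the orbit multiplied by the
  tent-shaped weight \<open>w\<^sub>k = exp (\<nu> (m - n) - \<nu> \<bar>k - m\<bar>)\<close> with \<open>exp \<nu> - 1 < c\<close>: away from
  \<open>k = n\<close> the image under \<open>G\<^sub>\<alpha>\<close> is at most \<open>exp \<nu> - 1\<close> times the weighted orbit, so the bound
  can only come from the entry at \<open>n\<close>, and evaluating the weighted orbit at \<open>m\<close> yields the decay.
  The construction needs \<open>n \<ge> 1\<close> because sequences in \<open>c\<^sub>0\<^sub>0(\<alpha>)\<close> vanish at \<open>0\<close>; orbits starting at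
  time \<open>0\<close> are treated by passing to time \<open>1\<close>.
\<close>

section \<open>Norm properties of the adapted norms and of \<open>c00\<close>\<close>

lemma adapted_norm_nonneg:
  assumes "\<alpha> \<in> admissible_exponents A"
  shows "0 \<le> adapted_norm A \<alpha> n x"
  using norm_le_adapted_norm[OF assms] norm_ge_zero order_trans by blast

lemma adapted_norm_scaleR:
  assumes "\<alpha> \<in> admissible_exponents A"
  shows "adapted_norm A \<alpha> n (r *\<^sub>R x) = \<bar>r\<bar> * adapted_norm A \<alpha> n x"
proof -
  have le: "adapted_norm A \<alpha> n (s *\<^sub>R y) \<le> \<bar>s\<bar> * adapted_norm A \<alpha> n y" for s y
    unfolding adapted_norm_def[of A \<alpha> n "s *\<^sub>R y"]
  proof (rule cSUP_least)
    fix m assume m: "m \<in> {n..}"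
    have "exp (- \<alpha> * real (m - n)) * norm (cocycle A m n y) \<le> adapted_norm A \<alpha> n y"
      unfolding adapted_norm_def by (rule cSUP_upper[OF m bdd_above_adapted[OF assms]])
    then have "\<bar>s\<bar> * (exp (- \<alpha> * real (m - n)) * norm (cocycle A m n y))
        \<le> \<bar>s\<bar> * adapted_norm A \<alpha> n y"
      by (rule mult_left_mono) simp
    then show "exp (- \<alpha> * real (m - n)) * norm (cocycle A m n (s *\<^sub>R y))
        \<le> \<bar>s\<bar> * adapted_norm A \<alpha> n y"
      by (simp add: blinfun.scaleR_right mult.left_commute)
  qed simp
  show ?thesis
  proof (cases "r = 0")
    case True
    then show ?thesis
      using le[of 0 x] adapted_norm_nonneg[OF assms, of n 0] by simp
  next
    case False
    \<comment> \<open>The reverse inequality is \<open>le\<close> again, for the scalar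
      \<open>inverse r\<close> acting on \<open>r *\<^sub>R x\<close>.\<close>
    have "adapted_norm A \<alpha> n (inverse r *\<^sub>R (r *\<^sub>R x))
        \<le> \<bar>inverse r\<bar> * adapted_norm A \<alpha> n (r *\<^sub>R x)"
      by (rule le)
    then have "\<bar>r\<bar> * adapted_norm A \<alpha> n x \<le> adapted_norm A \<alpha> n (r *\<^sub>R x)"
      using False by (simp add: field_simps)
    then show ?thesis using le[of r x] by simp
  qed
qed

lemma adapted_norm_le_c00_norm:
  assumes "u \<in> c00 A \<alpha>"
  shows "adapted_norm A \<alpha> n (u n) \<le> c00_norm A \<alpha> u"
  unfolding c00_norm_def by (rule cSUP_upper[OF _ bdd_above_c00[OF assms]]) simp

lemma c00_norm_le:
  assumes "\<And>n. adapted_norm A \<alpha> n (u n) \<le> b"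
  shows "c00_norm A \<alpha> u \<le> b"
  unfolding c00_norm_def by (rule cSUP_least) (use assms in auto)

lemma c00_norm_nonneg:
  assumes "\<alpha> \<in> admissible_exponents A" "u \<in> c00 A \<alpha>"
  shows "0 \<le> c00_norm A \<alpha> u"
  using adapted_norm_nonneg[OF assms(1)] adapted_norm_le_c00_norm[OF assms(2)] order_trans
  by blast

lemma c00_norm_scaleR:
  assumes "\<alpha> \<in> admissible_exponents A" "u \<in> c00 A \<alpha>"
  shows "c00_norm A \<alpha> (\<lambda>n. r *\<^sub>R u n) = \<bar>r\<bar> * c00_norm A \<alpha> u"
proof -
  \<comment> \<open>Multiplication by \<open>\<bar>r\<bar>\<close> is monotone and continuous, so it
    commutes with the supremum of a nonempty bounded set.\<close>
  have "\<bar>r\<bar> * (SUP n. adapted_norm A \<alpha> n (u n)) = (SUP n. \<bar>r\<bar> * adapted_norm A \<alpha> n (u n))"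
    using continuous_at_Sup_mono[OF _ _ _ bdd_above_c00[OF assms(2)], of "\<lambda>x. \<bar>r\<bar> * x"]
    by (simp add: mono_def mult_left_mono image_image continuous_intros)
  then show ?thesis
    by (simp add: c00_norm_def adapted_norm_scaleR[OF assms(1)])
qed

lemma c00_scaleR:
  assumes "\<alpha> \<in> admissible_exponents A" "u \<in> c00 A \<alpha>"
  shows "(\<lambda>n. r *\<^sub>R u n) \<in> c00 A \<alpha>"
  using assms(2) tendsto_mult_right_zero[of "\<lambda>n. adapted_norm A \<alpha> n (u n)" sequentially "\<bar>r\<bar>"]
  by (auto simp: c00_def adapted_norm_scaleR[OF assms(1)])

lemma G_op_apply:
  assumes "u \<in> c00 A \<alpha>"
  shows "G_op A \<alpha> u n = (if n = 0 then 0 else A (n - 1) (u (n - 1))) - u n"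
  using assms by (simp add: G_op_def T_op_def evolution_map_def)

lemma adapted_norm_add_le:
  assumes "\<alpha> \<in> admissible_exponents A"
  shows "adapted_norm A \<alpha> n (x + y) \<le> adapted_norm A \<alpha> n x + adapted_norm A \<alpha> n y"
  unfolding adapted_norm_def[of A \<alpha> n "x + y"]
proof (rule cSUP_least)
  fix m assume m: "m \<in> {n..}"
  have *: "exp (- \<alpha> * real (m - n)) * norm (cocycle A m n z) \<le> adapted_norm A \<alpha> n z" for z
    unfolding adapted_norm_def by (rule cSUP_upper[OF m bdd_above_adapted[OF assms]])
  have "exp (- \<alpha> * real (m - n)) * norm (cocycle A m n (x + y))
      \<le> exp (- \<alpha> * real (m - n)) * norm (cocycle A m n x)
        + exp (- \<alpha> * real (m - n)) * norm (cocycle A m n y)"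
    by (simp add: blinfun.add_right distrib_left[symmetric] norm_triangle_ineq)
  with *[of x] *[of y]
  show "exp (- \<alpha> * real (m - n)) * norm (cocycle A m n (x + y))
      \<le> adapted_norm A \<alpha> n x + adapted_norm A \<alpha> n y"
    by linarith
qed simp

text \<open>This makes \<open>c00_norm A \<alpha> (G_op A \<alpha> u)\<close> a genuine supremum, so
  that nonnegativity and homogeneity of \<open>c00_norm\<close> apply to it.\<close>

lemma G_op_c00:
  assumes "\<alpha> \<in> admissible_exponents A" "u \<in> c00 A \<alpha>"
  shows "G_op A \<alpha> u \<in> c00 A \<alpha>"
proof -
  have G: "G_op A \<alpha> u n = T_op A \<alpha> u n + (-1) *\<^sub>R u n" for n
    using assms(2) by (simp add: G_op_def)
  have T: "T_op A \<alpha> u \<in> c00 A \<alpha>"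
    by (rule T_op_c00[OF assms])
  have lim: "(\<lambda>n. adapted_norm A \<alpha> n (T_op A \<alpha> u n) + adapted_norm A \<alpha> n (u n)) \<longlonglongrightarrow> 0"
    using T assms(2) by (intro tendsto_add_zero) (auto simp: c00_def)
  have "(\<lambda>n. adapted_norm A \<alpha> n (G_op A \<alpha> u n)) \<longlonglongrightarrow> 0"
  proof (rule tendsto_sandwich[OF _ _ tendsto_const lim])
    show "\<forall>\<^sub>F n in sequentially. 0 \<le> adapted_norm A \<alpha> n (G_op A \<alpha> u n)"
      by (simp add: adapted_norm_nonneg[OF assms(1)])
    show "\<forall>\<^sub>F n in sequentially. adapted_norm A \<alpha> n (G_op A \<alpha> u n)
        \<le> adapted_norm A \<alpha> n (T_op A \<alpha> u n) + adapted_norm A \<alpha> n (u n)"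
      unfolding G
      using adapted_norm_add_le[OF assms(1)] adapted_norm_scaleR[OF assms(1), where r = "-1"]
      by (intro always_eventually allI) (metis abs_minus_cancel abs_one mult_1)
  qed
  then show ?thesis
    using T assms(2) by (simp add: G c00_def)
qed

section \<open>The lower bound for \<open>G_op\<close>\<close>

text \<open>Negating membership in the spectrum bounds \<open>G_op\<close> below on the unit sphere;
  homogeneity carries the bound to every \<open>u\<close> of nonzero norm, and norm zero is
  trivial.\<close>

lemma bounded_below_if_zero_not_approx_eigenvalue:
  assumes adm: "\<alpha> \<in> admissible_exponents A"
    and "0 \<notin> approx_point_spectrum (c00 A \<alpha>) (c00_norm A \<alpha>) (G_op A \<alpha>)"
  obtains c where "0 < c" "\<And>u. u \<in> c00 A \<alpha> \<Longrightarrow> c * c00_norm A \<alpha> u \<le> c00_norm A \<alpha> (G_op A \<alpha> u)"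
proof -
  obtain \<epsilon> where \<epsilon>: "0 < \<epsilon>"
    "\<And>u. u \<in> c00 A \<alpha> \<Longrightarrow> c00_norm A \<alpha> u = 1 \<Longrightarrow>
       \<epsilon> < c00_norm A \<alpha> (\<lambda>n. 0 *\<^sub>R u n - G_op A \<alpha> u n)"
    using assms(2) unfolding approx_point_spectrum_def by (auto simp: not_le)
  have "\<epsilon> * c00_norm A \<alpha> u \<le> c00_norm A \<alpha> (G_op A \<alpha> u)" if u: "u \<in> c00 A \<alpha>" for u
  proof (cases "c00_norm A \<alpha> u = 0")
    case True
    then show ?thesis using c00_norm_nonneg[OF adm G_op_c00[OF adm u]] by simp
  next
    case False
    define s where "s = c00_norm A \<alpha> u"
    have s: "0 < s" using False c00_norm_nonneg[OF adm u] by (simp add: s_def)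
    define v where "v = (\<lambda>n. inverse s *\<^sub>R u n)"
    have v: "v \<in> c00 A \<alpha>" unfolding v_def by (rule c00_scaleR[OF adm u])
    have "c00_norm A \<alpha> v = 1"
      unfolding v_def c00_norm_scaleR[OF adm u] using s by (simp add: s_def)
    from \<epsilon>(2)[OF v this]
    have "\<epsilon> < c00_norm A \<alpha> (\<lambda>n. 0 *\<^sub>R v n - G_op A \<alpha> v n)" .
    also have "(\<lambda>n. 0 *\<^sub>R v n - G_op A \<alpha> v n) = (\<lambda>n. (- inverse s) *\<^sub>R G_op A \<alpha> u n)"
      unfolding G_op_apply[OF u] G_op_apply[OF v]
      by (auto simp: v_def blinfun.scaleR_right scaleR_diff_right)
    also have "c00_norm A \<alpha> \<dots> = inverse s * c00_norm A \<alpha> (G_op A \<alpha> u)"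
      unfolding c00_norm_scaleR[OF adm G_op_c00[OF adm u]] using s by simp
    finally show ?thesis using s by (simp add: s_def[symmetric] field_simps)
  qed
  with \<epsilon>(1) show ?thesis by (rule that)
qed

section \<open>Decay of bounded orbits by weighted test sequences\<close>

lemma cocycle_compose:
  assumes "n \<le> k" "k \<le> j"
  shows "cocycle A j k (cocycle A k n x) = cocycle A j n x"
  using assms(2)
proof (induction j rule: dec_induct)
  case (step j)
  then show ?case using assms(1) by simp
qed simp

text \<open>The bound on the orbit serves to place the weighted orbit in \<open>c00\<close> and does
  not enter the estimate. This is why the final constants are uniform over all bounded
  orbits.\<close>

lemma bounded_orbit_decay:
  fixes A :: "nat \<Rightarrow> 'a::banach \<Rightarrow>\<^sub>L 'a"
  assumes adm: "\<alpha> \<in> admissible_exponents A" and "0 \<le> \<alpha>"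
    and lower: "\<And>u. u \<in> c00 A \<alpha> \<Longrightarrow> c * c00_norm A \<alpha> u \<le> c00_norm A \<alpha> (G_op A \<alpha> u)"
    and \<nu>: "0 < \<nu>" "exp \<nu> - 1 < c"
    and bdd: "bdd_above ((\<lambda>m. norm (cocycle A m n x)) ` {n..})"
    and "0 < n" and "n \<le> m"
  shows "c * (exp (\<nu> * real (m - n)) * norm (cocycle A m n x)) \<le> adapted_norm A \<alpha> n x"
proof -
  define a where "a k = adapted_norm A \<alpha> k (cocycle A k n x)" for k
  \<comment> \<open>The weight is 1 at \<open>n\<close>, peaks at \<open>m\<close> with value
    \<open>exp (\<nu> * real (m - n))\<close>, and then decays to 0; consecutive values differ by a
    factor \<open>exp \<nu>\<close>.\<close>
  define w where "w k = exp (\<nu> * real (m - n) - \<nu> * \<bar>real k - real m\<bar>)" for k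
  define u where "u k = (if k < n then 0 else w k *\<^sub>R cocycle A k n x)" for k
  obtain b where b: "\<And>k. n \<le> k \<Longrightarrow> norm (cocycle A k n x) \<le> b"
    using bdd unfolding bdd_above_def by auto
  have a_nonneg: "0 \<le> a k" for k
    unfolding a_def by (rule adapted_norm_nonneg[OF adm])
  have a_le: "a k \<le> b" if "n \<le> k" for k
    unfolding a_def adapted_norm_def
  proof (rule cSUP_least)
    fix j assume j: "j \<in> {k..}"
    \<comment> \<open>Since \<alpha> \<ge> 0, the exponential factor is at most 1, so the bound
      \<open>b\<close> of the orbit also bounds its adapted norms.\<close>
    have "exp (- \<alpha> * real (j - k)) * norm (cocycle A j n x) \<le> 1 * norm (cocycle A j n x)"
      using \<open>0 \<le> \<alpha>\<close> by (intro mult_right_mono) auto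
    also have "\<dots> \<le> b" using b[of j] j that by simp
    finally show "exp (- \<alpha> * real (j - k)) * norm (cocycle A j k (cocycle A k n x)) \<le> b"
      using j that by (simp add: cocycle_compose)
  qed simp
  have w_pos: "0 < w k" for k
    by (simp add: w_def)
  have au: "adapted_norm A \<alpha> k (u k) = (if k < n then 0 else w k * a k)" for k
    using adapted_norm_scaleR[OF adm, of k 0 0] w_pos[of k]
    by (simp add: u_def a_def adapted_norm_scaleR[OF adm])
  have w_lim: "w \<longlonglongrightarrow> 0"
  proof -
    have "filterlim (\<lambda>k. real k - real m) at_top sequentially"
      using filterlim_tendsto_add_at_top[OF tendsto_const[of "- real m"] filterlim_real_sequentially]
      by simp
    then have "filterlim (\<lambda>k. \<bar>real k - real m\<bar>) at_top sequentially"
      by (rule filterlim_at_top_mono) (intro always_eventually allI abs_ge_self)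
    then have "filterlim (\<lambda>k. \<nu> * \<bar>real k - real m\<bar>) at_top sequentially"
      by (rule filterlim_tendsto_pos_mult_at_top[OF tendsto_const \<nu>(1)])
    then have "((\<lambda>k. exp (- (\<nu> * \<bar>real k - real m\<bar>))) \<longlongrightarrow> 0) sequentially"
      by (intro filterlim_compose[OF exp_at_bot]) (simp add: filterlim_uminus_at_top[symmetric])
    from tendsto_mult_right_zero[OF this, of "exp (\<nu> * real (m - n))"] show ?thesis
      by (simp add: w_def[abs_def] exp_add[symmetric])
  qed
  have b_nonneg: "0 \<le> b" using a_nonneg a_le order_trans by blast
  have "(\<lambda>k. adapted_norm A \<alpha> k (u k)) \<longlonglongrightarrow> 0"
  proof (rule tendsto_sandwich[OF _ _ tendsto_const])
    show "(\<lambda>k. w k * b) \<longlonglongrightarrow> 0" by (rule tendsto_mult_left_zero[OF w_lim])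
    show "\<forall>\<^sub>F k in sequentially. 0 \<le> adapted_norm A \<alpha> k (u k)"
      by (simp add: adapted_norm_nonneg[OF adm])
    show "\<forall>\<^sub>F k in sequentially. adapted_norm A \<alpha> k (u k) \<le> w k * b"
      using w_pos b_nonneg a_le by (auto simp: au less_imp_le intro!: always_eventually)
  qed
  then have u: "u \<in> c00 A \<alpha>"
    using \<open>0 < n\<close> by (simp add: c00_def u_def)
  \<comment> \<open>The bound is stated with \<open>w (Suc k)\<close> because the entry of
    \<open>G_op A \<alpha> u\<close> at \<open>Suc k\<close> is to be compared with
    \<open>u (Suc k)\<close>. It is an equality from the peak on; before it, an extra factor
    \<open>exp \<nu>\<close> is given away.\<close>
  have w_step: "\<bar>w k - w (Suc k)\<bar> \<le> (exp \<nu> - 1) * w (Suc k)" for k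
  proof -
    have "w (Suc k) = exp \<nu> * w k \<or> w k = exp \<nu> * w (Suc k)"
    proof (cases "k < m")
      case True
      then have "\<bar>real k - real m\<bar> = \<bar>real (Suc k) - real m\<bar> + 1" by simp
      then have "w (Suc k) = exp \<nu> * w k"
        by (simp add: w_def exp_add[symmetric] algebra_simps)
      then show ?thesis ..
    next
      case False
      then have "w k = exp \<nu> * w (Suc k)"
        by (simp add: w_def exp_add[symmetric] algebra_simps)
      then show ?thesis ..
    qed
    then show ?thesis
    proof
      assume *: "w (Suc k) = exp \<nu> * w k"
      have "1 * ((exp \<nu> - 1) * w k) \<le> exp \<nu> * ((exp \<nu> - 1) * w k)"
        using \<nu>(1) w_pos[of k] by (intro mult_right_mono) auto
      moreover have "w k \<le> exp \<nu> * w k"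
        using \<nu>(1) w_pos[of k] by simp
      ultimately show ?thesis unfolding * by (simp add: algebra_simps)
    next
      assume *: "w k = exp \<nu> * w (Suc k)"
      have "w (Suc k) \<le> exp \<nu> * w (Suc k)"
        using \<nu>(1) w_pos[of "Suc k"] by simp
      with * show ?thesis by (simp add: algebra_simps)
    qed
  qed
  let ?b = "max (a n) ((exp \<nu> - 1) * c00_norm A \<alpha> u)"
  have "c00_norm A \<alpha> (G_op A \<alpha> u) \<le> ?b"
  proof (rule c00_norm_le)
    fix k
    consider "k < n" | "k = n" | j where "k = Suc j" "n \<le> j"
      by (metis less_Suc_eq_le linorder_neqE_nat not0_implies_Suc not_less0)
    then show "adapted_norm A \<alpha> k (G_op A \<alpha> u k) \<le> ?b"
    proof cases
      case 1
      \<comment> \<open>Zero is written as a multiple by 0 so that homogeneity gives its adapted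
        norm.\<close>
      then have "G_op A \<alpha> u k = 0 *\<^sub>R 0"
        by (simp add: G_op_apply[OF u] u_def less_imp_diff_less)
      then show ?thesis
        using a_nonneg[of n] adapted_norm_scaleR[OF adm, of k 0 0] by simp
    next
      case 2
      \<comment> \<open>As \<open>n\<close> is positive and \<open>u (n - 1) = 0\<close>, nothing
        flows into this entry: it is minus the initial vector.\<close>
      have "w n = 1" using \<open>n \<le> m\<close> by (simp add: w_def of_nat_diff)
      then have "G_op A \<alpha> u k = (-1) *\<^sub>R cocycle A n n x"
        using 2 \<open>0 < n\<close> by (simp add: G_op_apply[OF u] u_def)
      then have "adapted_norm A \<alpha> k (G_op A \<alpha> u k) = a n"
        using 2 by (simp only: adapted_norm_scaleR[OF adm] a_def)
      then show ?thesis by simp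
    next
      case 3
      \<comment> \<open>\<open>A j\<close> maps the orbit at \<open>j\<close> to the orbit at
        \<open>k\<close>, so only the change of weight remains.\<close>
      have "G_op A \<alpha> u k = (w j - w (Suc j)) *\<^sub>R cocycle A k n x"
        using 3 by (simp add: G_op_apply[OF u] u_def blinfun.scaleR_right scaleR_diff_left)
      then have "adapted_norm A \<alpha> k (G_op A \<alpha> u k) = \<bar>w j - w (Suc j)\<bar> * a k"
        by (simp only: adapted_norm_scaleR[OF adm] a_def)
      also have "\<dots> \<le> ((exp \<nu> - 1) * w (Suc j)) * a k"
        by (rule mult_right_mono[OF w_step a_nonneg])
      also have "\<dots> = (exp \<nu> - 1) * adapted_norm A \<alpha> k (u k)"
        using 3 by (simp add: au)
      also have "\<dots> \<le> (exp \<nu> - 1) * c00_norm A \<alpha> u"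
        using \<nu>(1) by (intro mult_left_mono adapted_norm_le_c00_norm[OF u]) auto
      finally show ?thesis by simp
    qed
  qed
  with lower[OF u] have "c * c00_norm A \<alpha> u \<le> ?b" by simp
  \<comment> \<open>If the maximum is its second term, \<open>exp \<nu> - 1 < c\<close> forces
    \<open>u\<close> to have norm 0, so the bound by \<open>a n\<close> holds in either
    case.\<close>
  moreover have "c * c00_norm A \<alpha> u \<le> a n"
    if "c * c00_norm A \<alpha> u \<le> (exp \<nu> - 1) * c00_norm A \<alpha> u"
  proof -
    have "\<not> 0 < c00_norm A \<alpha> u" using that \<nu>(2) by auto
    then have "c00_norm A \<alpha> u = 0" using c00_norm_nonneg[OF adm u] by simp
    then show ?thesis using a_nonneg[of n] by simp
  qed
  ultimately have "c * c00_norm A \<alpha> u \<le> a n" by linarith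
  moreover have "exp (\<nu> * real (m - n)) * norm (cocycle A m n x) \<le> c00_norm A \<alpha> u"
  proof -
    have "exp (\<nu> * real (m - n)) * norm (cocycle A m n x) \<le> exp (\<nu> * real (m - n)) * a m"
      unfolding a_def using norm_le_adapted_norm[OF adm] by (intro mult_left_mono) auto
    also have "\<dots> = adapted_norm A \<alpha> m (u m)"
      using \<open>n \<le> m\<close> by (simp add: au w_def)
    also have "\<dots> \<le> c00_norm A \<alpha> u" by (rule adapted_norm_le_c00_norm[OF u])
    finally show ?thesis .
  qed
  moreover have "0 < c" using \<nu> exp_gt_one[of \<nu>] by linarith
  ultimately have "c * (exp (\<nu> * real (m - n)) * norm (cocycle A m n x)) \<le> a n"
    by (meson mult_left_mono less_imp_le order_trans)
  then show ?thesis by (simp add: a_def)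
qed

section \<open>Choice of the uniform constants\<close>

theorem theorem4p1:
  fixes A :: "nat \<Rightarrow> 'a::banach \<Rightarrow>\<^sub>L 'a"
  assumes "\<exists>\<alpha>\<in>admissible_exponents A.
             0 \<notin> approx_point_spectrum (c00 A \<alpha>) (c00_norm A \<alpha>) (G_op A \<alpha>)"
  shows "\<exists>\<nu>>0. \<exists>N :: nat \<Rightarrow> real. (\<forall>k. 0 < N k) \<and>
           (\<forall>n x\<^sub>0. bdd_above ((\<lambda>m. norm (cocycle A m n x\<^sub>0)) ` {n..}) \<longrightarrow>
              (\<forall>m\<ge>n. norm (cocycle A m n x\<^sub>0) \<le> N n * exp (- \<nu> * real (m - n)) * norm x\<^sub>0))"
proof -
  obtain \<alpha> where adm: "\<alpha> \<in> admissible_exponents A"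
    and ap: "0 \<notin> approx_point_spectrum (c00 A \<alpha>) (c00_norm A \<alpha>) (G_op A \<alpha>)"
    using assms by blast
  obtain M where M_pos: "\<And>n. 0 < M n"
    and M: "\<forall>m n. n \<le> m \<longrightarrow> norm (cocycle A m n) \<le> M n * exp (\<alpha> * real (m - n))"
    using adm unfolding admissible_exponents_def by blast
  show ?thesis
  proof (cases "\<alpha> < 0")
    case True
    have "norm (cocycle A m n x) \<le> M n * exp (- (- \<alpha>) * real (m - n)) * norm x"
      if "n \<le> m" for m n x
    proof -
      have "norm (cocycle A m n x) \<le> norm (cocycle A m n) * norm x" by (rule norm_blinfun)
      also have "\<dots> \<le> (M n * exp (\<alpha> * real (m - n))) * norm x"
        using M that by (intro mult_right_mono) auto
      finally show ?thesis by simp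
    qed
    with True M_pos show ?thesis
      by (intro exI[of _ "- \<alpha>"] conjI exI[of _ M]) auto
  next
    case False
    obtain c where c: "0 < c"
      "\<And>u. u \<in> c00 A \<alpha> \<Longrightarrow> c * c00_norm A \<alpha> u \<le> c00_norm A \<alpha> (G_op A \<alpha> u)"
      using bounded_below_if_zero_not_approx_eigenvalue[OF adm ap] by blast
    \<comment> \<open>With this choice \<open>exp \<nu> - 1 = c / 2\<close>.\<close>
    define \<nu> where "\<nu> = ln (1 + c / 2)"
    have \<nu>: "0 < \<nu>" "exp \<nu> - 1 < c"
      using c(1) by (simp_all add: \<nu>_def)
    have decay: "norm (cocycle A m n x) \<le> M n / c * exp (- \<nu> * real (m - n)) * norm x"
      if "bdd_above ((\<lambda>m. norm (cocycle A m n x)) ` {n..})" "0 < n" "n \<le> m" for m n x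
    proof -
      have "c * (exp (\<nu> * real (m - n)) * norm (cocycle A m n x)) \<le> M n * norm x"
        using bounded_orbit_decay[OF adm _ c(2) \<nu> that] False adapted_norm_le[OF M, of n x]
        by simp
      then show ?thesis using c(1) by (simp add: exp_minus field_simps)
    qed
    \<comment> \<open>At time 0 the second term pays for the first step \<open>A 0\<close> and,
      through \<open>exp \<nu>\<close>, for the exponent \<open>m - 1\<close> in place of
      \<open>m\<close>. The 1 covers \<open>m = 0\<close> and keeps the constant positive even when
      \<open>A 0\<close> vanishes.\<close>
    define N where
      "N n = (if n = 0 then max 1 (M 1 / c * exp \<nu> * norm (A 0)) else M n / c)" for n
    have "0 < N n" for n
      using M_pos c(1) by (simp add: N_def less_max_iff_disj)
    moreover have "norm (cocycle A m n x) \<le> N n * exp (- \<nu> * real (m - n)) * norm x"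
      if bdd: "bdd_above ((\<lambda>m. norm (cocycle A m n x)) ` {n..})" and "n \<le> m" for m n x
    proof (cases "n = 0")
      case False
      with decay[OF bdd _ \<open>n \<le> m\<close>] show ?thesis by (simp add: N_def)
    next
      case n: True
      show ?thesis
      proof (cases "m = 0")
        case True
        have "1 * norm x \<le> N 0 * norm x" by (intro mult_right_mono) (auto simp: N_def)
        then show ?thesis using n True by simp
      next
        case False
        have shift: "cocycle A j 1 (A 0 x) = cocycle A j 0 x" if "1 \<le> j" for j
          using cocycle_Suc_right[of 0 j A] that by simp
        obtain b where b: "\<And>j. norm (cocycle A j 0 x) \<le> b"
          using bdd unfolding n bdd_above_def by auto
        \<comment> \<open>The orbit of \<open>A 0 x\<close> from time 1 is the tail of the given
          orbit, hence bounded, and \<open>decay\<close> applies at the positive time 1.\<close>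
        have "bdd_above ((\<lambda>j. norm (cocycle A j 1 (A 0 x))) ` {1..})"
          by (rule bdd_aboveI2[where M = b]) (use b shift in auto)
        from decay[OF this, of m] False
        have "norm (cocycle A m 0 x) \<le> M 1 / c * exp (- \<nu> * real (m - 1)) * norm (A 0 x)"
          using shift[of m] by simp
        also have "\<dots> \<le> M 1 / c * exp (- \<nu> * real (m - 1)) * (norm (A 0) * norm x)"
          using M_pos[of 1] c(1) by (intro mult_left_mono norm_blinfun) auto
        also have "exp (- \<nu> * real (m - 1)) = exp \<nu> * exp (- \<nu> * real m)"
          using False by (simp add: exp_add[symmetric] of_nat_diff algebra_simps)
        also have "M 1 / c * (exp \<nu> * exp (- \<nu> * real m)) * (norm (A 0) * norm x)
            = (M 1 / c * exp \<nu> * norm (A 0)) * (exp (- \<nu> * real m) * norm x)"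
          by simp
        also have "\<dots> \<le> N 0 * (exp (- \<nu> * real m) * norm x)"
          by (intro mult_right_mono) (auto simp: N_def)
        finally show ?thesis using n by (simp add: mult.assoc)
      qed
    qed
    ultimately show ?thesis using \<nu>(1) by blast
  qed
qed

end
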